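(* Let $\rho>1$, $\sigma\geq 0$ and $C_{\Upsilon}>0$ be real numbers. Let $\gamma_\emptyset=1$ and, for every nonempty finite $v\subseteq\mathbb{N}$, $$\gamma_v=(|v|!)^{\sigma}\prod_{j\in v} \frac{C_{\Upsilon}}{j^{\rho}},$$ and for real $m>0$ let $S_{\boldsymbol{\gamma}}(m)=\sum_{v\subseteq \mathbb{N}}\gamma_v m^{|v|}$. Then $S_{\boldsymbol{\gamma}}(m)<\infty$ for all $m> 0$ if and only if $\rho>\sigma$, in which case $$\liminf_{m\to\infty} m^{-\frac{1}{\rho-\sigma}}\log S_{\boldsymbol{\gamma}}(m)\geq (\rho-\sigma)C_{\Upsilon}^{\frac{1}{\rho-\sigma}}$$ and $$\limsup_{m\to\infty}m^{-\frac{1}{\rho-\sigma}}\log S_{\boldsymbol{\gamma}}(m)\leq (\rho-\sigma)(C_{\rho}C_\Upsilon)^{\frac{1}{\rho-\sigma}}$$ for $C_{\rho}=\exp(1)/\min(\rho-1,1)$.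
   Context: $\mathbb{N}=\{1,2,3,\dots\}$. Sums over $v\subseteq\mathbb{N}$ run over all finite subsets of $\mathbb{N}$, including the empty set. $\log$ is the natural logarithm. *)

theory Defs
  imports "HOL-Analysis.Analysis"
begin

definition gamma_weight :: "real \<Rightarrow> real \<Rightarrow> real \<Rightarrow> nat set \<Rightarrow> real" where
  "gamma_weight \<rho> \<sigma> C v =
     (fact (card v)) powr \<sigma> * (\<Prod>j\<in>v. C / (real j powr \<rho>))"

text \<open>
  The sum takes values in \<open>[0, \<infinity>]\<close>. This presupposes \<open>C > 0\<close> and \<open>m > 0\<close>, since \<open>ennreal\<close>
  truncates negative numbers to 0. The positive integers are \<open>{1..}\<close>.
\<close>

definition S_gamma :: "real \<Rightarrow> real \<Rightarrow> real \<Rightarrow> real \<Rightarrow> ennreal" where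
  "S_gamma \<rho> \<sigma> C m =
     (\<Sum>\<^sub>\<infinity>v\<in>{v. v \<subseteq> {1..} \<and> finite v}. ennreal (gamma_weight \<rho> \<sigma> C v * m ^ card v))"

lemma gamma_weight_empty [simp]: "gamma_weight \<rho> \<sigma> C {} = 1"
  by (simp add: gamma_weight_def)

end

theory Submission
  imports Defs "HOL-Real_Asymp.Real_Asymp"
begin

text \<open>
  Group the sum by cardinality: with \<open>e\<^sub>k\<close> the elementary symmetric function of the numbers
  \<open>j powr (- \<rho>)\<close>, it becomes the sum of \<open>(k!) powr \<sigma> * (C * m) ^ k * e\<^sub>k\<close>.
  The set \<open>{1..k}\<close> alone gives \<open>e\<^sub>k \<ge> (k!) powr (- \<rho>)\<close>. Conversely, induction on the least
  admissible index together with Bernoulli's inequality gives, for \<open>\<beta> = min (\<rho> - 1) 1\<close>,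
  \<open>e\<^sub>k \<le> ((k + 1) ^ k / k!) / \<beta> ^ k * (k!) powr (- \<rho>)\<close>, and \<open>(k + 1) ^ k / k! \<le> e ^ (k + 1)\<close>.
  Up to constant factors the sum therefore lies between two series
  of the form \<open>\<Sum>k. (x ^ k / k!) powr (\<rho> - \<sigma>)\<close>, whose logarithm is asymptotic to \<open>(\<rho> - \<sigma>) * x\<close>.
\<close>

text \<open>The weighted inequality of arithmetic and geometric means for the numbers
  \<open>1 - u\<close> and \<open>1\<close> with weights \<open>\<beta>\<close> and
  \<open>1 - \<beta>\<close>.\<close>

lemma powr_Bernoulli:
  fixes u \<beta> :: real
  assumes "0 \<le> \<beta>" "\<beta> \<le> 1" "u < 1"
  shows "(1 - u) powr \<beta> \<le> 1 - \<beta> * u"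
  using Youngs_inequality_0[of \<beta> "1 - \<beta>" "1 - u" 1] assms by (simp add: algebra_simps)

section \<open>Elementary symmetric functions over finite sets\<close>

definition esym :: "('a \<Rightarrow> 'b::comm_semiring_1) \<Rightarrow> 'a set \<Rightarrow> nat \<Rightarrow> 'b" where
  "esym a A k = (\<Sum>v | v \<subseteq> A \<and> card v = k. \<Prod>j\<in>v. a j)"

lemma esym_0 [simp]:
  assumes "finite A"
  shows "esym a A 0 = 1"
proof -
  have "{v. v \<subseteq> A \<and> card v = 0} = {{}}"
    using assms finite_subset by (auto simp: card_eq_0_iff)
  then show ?thesis
    by (simp add: esym_def)
qed

lemma esym_empty_Suc [simp]:
  "esym a {} (Suc k) = 0"
proof -
  have none: "{v. v \<subseteq> {} \<and> card v = Suc k} = {}"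
    by auto
  show ?thesis
    unfolding esym_def none by simp
qed

text \<open>Pascal-type recursion: the subsets of size \<open>Suc k\<close> are split according to
  whether they contain \<open>i\<close>.\<close>

lemma esym_insert_Suc:
  assumes A: "finite A" and i: "i \<notin> A"
  shows "esym a (insert i A) (Suc k) = a i * esym a A k + esym a A (Suc k)"
proof -
  let ?P = "\<lambda>k. {v. v \<subseteq> A \<and> card v = k}"
  have fin: "finite (?P k)" for k
    using A by (auto intro: finite_subset[of _ "Pow A"])
  have split: "{v. v \<subseteq> insert i A \<and> card v = Suc k} = insert i ` ?P k \<union> ?P (Suc k)" (is "?L = ?R")
  proof
    show "?R \<subseteq> ?L"
      using i A by (auto simp: card_insert_if finite_subset)
  next
    show "?L \<subseteq> ?R"
    proof
      fix v assume v: "v \<in> ?L"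
      then have fv: "finite v"
        using A finite_subset by blast
      show "v \<in> ?R"
      proof (cases "i \<in> v")
        case True
        then have "v - {i} \<in> ?P k" "v = insert i (v - {i})"
          using v fv by auto
        then show ?thesis by blast
      qed (use v in auto)
    qed
  qed
  have inj: "inj_on (insert i) (?P k)"
    using i by (auto simp: inj_on_def)
  have "(\<Sum>v\<in>insert i ` ?P k. \<Prod>j\<in>v. a j) = (\<Sum>v\<in>?P k. \<Prod>j\<in>insert i v. a j)"
    by (simp add: sum.reindex[OF inj])
  also have "\<dots> = (\<Sum>v\<in>?P k. a i * (\<Prod>j\<in>v. a j))"
  proof (rule sum.cong[OF refl])
    fix v assume "v \<in> ?P k"
    then have "finite v" "i \<notin> v"
      using A i finite_subset by auto
    then show "(\<Prod>j\<in>insert i v. a j) = a i * (\<Prod>j\<in>v. a j)"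
      by simp
  qed
  finally have image: "(\<Sum>v\<in>insert i ` ?P k. \<Prod>j\<in>v. a j) = a i * esym a A k"
    by (simp add: esym_def sum_distrib_left)
  have "esym a (insert i A) (Suc k)
      = (\<Sum>v\<in>insert i ` ?P k. \<Prod>j\<in>v. a j) + (\<Sum>v\<in>?P (Suc k). \<Prod>j\<in>v. a j)"
    unfolding esym_def split using fin i by (intro sum.union_disjoint) auto
  then show ?thesis
    using image by (simp add: esym_def)
qed

lemma sum_Pow_by_card:
  assumes "finite A"
  shows "(\<Sum>v\<in>Pow A. f (card v) * (\<Prod>j\<in>v. a j)) = (\<Sum>k\<le>card A. f k * esym a A k)"
proof -
  have "(\<Sum>v\<in>Pow A. f (card v) * (\<Prod>j\<in>v. a j))
      = (\<Sum>k\<le>card A. \<Sum>v | v \<in> Pow A \<and> card v = k. f (card v) * (\<Prod>j\<in>v. a j))"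
    using assms by (intro sum.group[symmetric]) (auto simp: card_mono)
  also have "\<dots> = (\<Sum>k\<le>card A. f k * esym a A k)"
    unfolding esym_def sum_distrib_left by (intro sum.cong) auto
  finally show ?thesis .
qed

section \<open>Upper bound for the elementary symmetric functions of
  \<open>1 / j powr \<rho>\<close>\<close>

lemma one_plus_inverse_power_le:
  fixes N :: real
  assumes "N > 0"
  shows "(1 + 1 / (N + real q)) ^ q \<le> (N + real q) / N"
proof (cases "q = 0")
  case False
  define M where "M = N + real q"
  have M: "M \<ge> 1" "M > real q"
    using assms False by (auto simp: M_def)
  \<comment> \<open>The factor \<open>1 - q / M\<close> equals \<open>N / M\<close>. By Bernoulli it
    is at most \<open>(1 - 1 / M) ^ q\<close>, which pairs with \<open>(1 + 1 / M) ^ q\<close> into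
    a power of a difference of squares.\<close>
  have "(1 + 1 / M) ^ q * (1 - real q / M) \<le> (1 + 1 / M) ^ q * (1 - 1 / M) ^ q"
    using Bernoulli_inequality[of "- (1 / M)" q] M
    by (intro mult_left_mono) (auto simp: field_simps)
  also have "\<dots> = (1 - (1 / M)\<^sup>2) ^ q"
    by (simp add: power_mult_distrib[symmetric] algebra_simps power2_eq_square)
  also have "\<dots> \<le> 1"
    using M by (intro power_le_one) (auto simp: field_simps power2_eq_square mult_ge1_I)
  also have "1 - real q / M = N / M"
    using M by (simp add: M_def field_simps)
  finally have "(1 + 1 / M) ^ q * (N / M) \<le> 1" .
  then have "(1 + 1 / M) ^ q * (N / M) * (M / N) \<le> 1 * (M / N)"
    using assms M by (intro mult_right_mono) auto
  then show ?thesis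
    using assms M unfolding M_def[symmetric] by simp
qed (use assms in auto)

text \<open>The induction step of \<open>esym_interval_le\<close>, divided by the bound to be proved
  there. With \<open>N\<close> the least index and \<open>q\<close> the size of the sets, the first
  summand is the share of the sets that contain \<open>N\<close>, the second that of the sets that
  avoid it.\<close>

lemma esym_step:
  fixes N \<beta> \<rho> :: real
  assumes "N > 0" "0 \<le> \<beta>" "\<beta> \<le> 1" "1 + \<beta> \<le> \<rho>"
  shows "\<beta> * real q / (N + real q)
    + (1 + 1 / (N + real q)) ^ q * (N / (N + real q)) powr \<rho> \<le> 1"
proof -
  define M where "M = N + real q"
  have M: "M > 0" "N / M \<le> 1" "N / M = 1 - real q / M" "N / M > 0"
    using assms by (auto simp: M_def field_simps)
  \<comment> \<open>One factor \<open>N / M\<close> will cancel the bound \<open>M / N\<close> on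
    \<open>(1 + 1 / M) ^ q\<close>. The exponent \<open>\<beta>\<close> that remains leaves, by
    Bernoulli, exactly the room taken by the first summand.\<close>
  have "(N / M) powr \<rho> \<le> (N / M) powr (1 + \<beta>)"
    using M assms by (intro powr_mono') auto
  also have "\<dots> = N / M * (1 - real q / M) powr \<beta>"
    using M by (simp add: powr_add)
  also have "\<dots> \<le> N / M * (1 - \<beta> * (real q / M))"
    using M assms by (intro mult_left_mono powr_Bernoulli) auto
  finally have "(N / M) powr \<rho> \<le> N / M * (1 - \<beta> * (real q / M))" .
  then have "(1 + 1 / M) ^ q * (N / M) powr \<rho> \<le> (M / N) * (N / M * (1 - \<beta> * (real q / M)))"
    using one_plus_inverse_power_le[OF \<open>N > 0\<close>, of q] M(1) assms
    unfolding M_def[symmetric] by (intro mult_mono) auto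
  also have "\<dots> = 1 - \<beta> * real q / M"
    using M assms by (simp add: field_simps)
  finally show ?thesis
    by (simp add: M_def)
qed

text \<open>
  The shift by \<open>n + 1\<close> in the base of the \<open>k\<close>-th power is what makes the bound reproduce itself
  when the least index is split off.
\<close>

lemma esym_interval_le:
  fixes \<beta> \<rho> :: real
  assumes \<beta>: "0 < \<beta>" "\<beta> \<le> 1" "1 + \<beta> \<le> \<rho>"
  shows "esym (\<lambda>j. 1 / real j powr \<rho>) {n+1..n+d} k
    \<le> (1 / \<beta>) ^ k * (real (n + 1 + k) ^ k / fact k) * (fact n / fact (n + k)) powr \<rho>"
proof (induction d arbitrary: n k)
  case 0
  show ?case
  proof (cases k)
    case (Suc l)
    then have "esym (\<lambda>j. 1 / real j powr \<rho>) {n+1..n+0} k = 0"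
      by simp
    also have "\<dots> \<le> (1 / \<beta>) ^ k * (real (n + 1 + k) ^ k / fact k) * (fact n / fact (n + k)) powr \<rho>"
      using \<beta> by (intro mult_nonneg_nonneg) auto
    finally show ?thesis .
  qed simp
next
  case (Suc d)
  show ?case
  proof (cases k)
    case 0
    then show ?thesis by simp
  next
    case k: (Suc l)
    define P :: real where "P = (fact n / fact (n + Suc l)) powr \<rho>"
    define M :: real where "M = real (n + 1) + real (Suc l)"
    \<comment> \<open>\<open>Q\<close> is the bound to be proved; the sets with and without
      \<open>n+1\<close> are each estimated by a multiple of it.\<close>
    define Q where "Q = (1 / \<beta>) ^ Suc l * (M ^ Suc l / fact (Suc l)) * P"
    have M: "M > 0" by (simp add: M_def)
    have Q: "Q \<ge> 0" using \<beta> M by (simp add: Q_def P_def)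
    have ins: "{n+1..n+Suc d} = insert (n+1) {Suc n+1..Suc n+d}" by auto
    have "1 / real (n+1) powr \<rho> * esym (\<lambda>j. 1 / real j powr \<rho>) {Suc n+1..Suc n+d} l
        \<le> 1 / real (n+1) powr \<rho> * ((1 / \<beta>) ^ l * (real (Suc n + 1 + l) ^ l / fact l)
            * (fact (Suc n) / fact (Suc n + l)) powr \<rho>)"
      by (intro mult_left_mono Suc.IH) auto
    also have "\<dots> = (1 / \<beta>) ^ l * (M ^ l / fact l) * P"
    proof -
      have "(fact (Suc n) / fact (Suc n + l)) powr \<rho> = real (n+1) powr \<rho> * P"
        unfolding P_def by (subst powr_mult[symmetric]) (auto simp: algebra_simps)
      then show ?thesis
        by (simp add: M_def add_ac)
    qed
    also have "\<dots> = Q * (\<beta> * real (Suc l) / M)"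
      using \<beta> M by (simp add: Q_def divide_simps fact_Suc del: of_nat_Suc)
    finally have first: "1 / real (n+1) powr \<rho> * esym (\<lambda>j. 1 / real j powr \<rho>) {Suc n+1..Suc n+d} l
        \<le> Q * (\<beta> * real (Suc l) / M)" .
    \<comment> \<open>For sets avoiding \<open>n+1\<close> the size does not drop, so the base in
      the induction hypothesis is \<open>M + 1\<close> instead of \<open>M\<close>. This costs
      \<open>(1 + 1 / M) ^ Suc l\<close>, to be paid for by the gain in the quotient of
      factorials.\<close>
    have "(fact (Suc n) / fact (Suc n + Suc l)) powr \<rho> = P * (real (n+1) / M) powr \<rho>"
      unfolding P_def by (subst powr_mult[symmetric]) (auto simp: M_def algebra_simps)
    moreover have "real (Suc n + 1 + Suc l) ^ Suc l = M ^ Suc l * (1 + 1 / M) ^ Suc l"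
    proof -
      have "real (Suc n + 1 + Suc l) = M * (1 + 1 / M)"
        using M by (simp add: distrib_left M_def)
      then show ?thesis
        by (simp only: power_mult_distrib)
    qed
    ultimately have second: "esym (\<lambda>j. 1 / real j powr \<rho>) {Suc n+1..Suc n+d} (Suc l)
        \<le> Q * ((1 + 1 / M) ^ Suc l * (real (n+1) / M) powr \<rho>)"
      using Suc.IH[of "Suc n" "Suc l"] by (simp add: Q_def mult_ac)
    have "esym (\<lambda>j. 1 / real j powr \<rho>) {n+1..n+Suc d} k
        \<le> Q * (\<beta> * real (Suc l) / M) + Q * ((1 + 1 / M) ^ Suc l * (real (n+1) / M) powr \<rho>)"
      unfolding k ins using first second by (subst esym_insert_Suc) auto
    also have "\<dots> \<le> Q * 1"
      using esym_step[of "real (n+1)" \<beta> \<rho> "Suc l"] \<beta> Q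
      unfolding M_def distrib_left[symmetric] by (intro mult_left_mono) auto
    finally show ?thesis
      by (simp add: k Q_def P_def M_def add_ac)
  qed
qed

lemma power_div_fact_le_exp:
  fixes x :: real
  assumes "x \<ge> 0"
  shows "x ^ k / fact k \<le> exp x"
proof -
  have "(\<Sum>i\<in>{k}. x ^ i / fact i) \<le> (\<Sum>i. x ^ i / fact i)"
    using assms summable_exp[of x] by (intro sum_le_suminf) (auto simp: divide_inverse mult_ac)
  then show ?thesis
    by (simp add: exp_def divide_inverse mult_ac)
qed

lemma esym_le:
  fixes \<rho> :: real
  assumes "\<rho> > 1"
  shows "esym (\<lambda>j. 1 / real j powr \<rho>) {1..L} k
    \<le> exp 1 * (exp 1 / min (\<rho> - 1) 1) ^ k * fact k powr (- \<rho>)"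
proof -
  \<comment> \<open>The largest value that \<open>esym_interval_le\<close> admits, hence its best
    bound.\<close>
  define \<beta> where "\<beta> = min (\<rho> - 1) 1"
  have \<beta>: "0 < \<beta>" "\<beta> \<le> 1" "1 + \<beta> \<le> \<rho>"
    using assms by (auto simp: \<beta>_def)
  have "real (k + 1) ^ k / fact k \<le> exp 1 * exp 1 ^ k"
    using power_div_fact_le_exp[of "real (k + 1)" k]
    by (simp add: exp_add exp_of_nat_mult[symmetric] mult_ac)
  then have "(1 / \<beta>) ^ k * (real (k + 1) ^ k / fact k) * (1 / fact k) powr \<rho>
      \<le> (1 / \<beta>) ^ k * (exp 1 * exp 1 ^ k) * (1 / fact k) powr \<rho>"
    using \<beta> by (intro mult_right_mono mult_left_mono) auto
  also have "\<dots> = exp 1 * (exp 1 / \<beta>) ^ k * fact k powr (- \<rho>)"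
    by (simp add: power_divide powr_divide powr_minus_divide)
  finally show ?thesis
    using esym_interval_le[OF \<beta>, of 0 L k] by (simp add: \<beta>_def add_ac)
qed

section \<open>Size of the series with terms \<open>(x ^ k / fact k) powr \<tau>\<close>\<close>

lemma ln_fact_le:
  assumes "k > 0"
  shows "ln (fact k :: real) \<le> real k * ln k - real k + ln k + 1"
  using assms
proof (induction k rule: nat_induct_non_zero)
  case (Suc k)
  \<comment> \<open>Passing from \<open>k\<close> to \<open>k + 1\<close> in this crude Stirling
    bound amounts to \<open>(k + 1) * ln ((k + 1) / k) \<ge> 1\<close>.\<close>
  have "ln (real k / real (k + 1)) \<le> real k / real (k + 1) - 1"
    using Suc by (intro ln_le_minus_one) auto
  also have "\<dots> = - (1 / real (k + 1))"
    by (simp add: field_simps)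
  finally have "real (k + 1) * (ln (real (k + 1)) - ln (real k)) \<ge> 1"
    using Suc by (simp add: ln_div field_simps)
  then show ?case
    using Suc ln_mult[of "real (k + 1)" "fact k"] by (simp add: algebra_simps)
qed simp

text \<open>The terms \<open>x ^ k / fact k\<close> peak at \<open>k = \<lfloor>x\<rfloor>\<close>,
  and this single term already reaches \<open>exp x\<close> up to a factor polynomial in
  \<open>x\<close>.\<close>

lemma power_div_fact_floor_ge:
  fixes x :: real
  assumes "x \<ge> 1"
  shows "ln (x ^ nat \<lfloor>x\<rfloor> / fact (nat \<lfloor>x\<rfloor>)) \<ge> x - 2 - ln x"
proof -
  define k where "k = nat \<lfloor>x\<rfloor>"
  have k: "real k \<le> x" "real k \<ge> x - 1" "k > 0"
    using assms by (auto simp: k_def le_nat_floor)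
  have "ln (real k) \<le> ln x"
    using k by simp
  moreover from this have "real k * ln (real k) \<le> real k * ln x"
    by (intro mult_left_mono) auto
  moreover have "ln (x ^ k / fact k) = real k * ln x - ln (fact k)"
    using \<open>x \<ge> 1\<close> by (simp add: ln_div ln_realpow)
  ultimately have "ln (x ^ k / fact k) \<ge> x - 2 - ln x"
    using ln_fact_le[OF \<open>k > 0\<close>] k by linarith
  then show ?thesis
    by (simp add: k_def)
qed

lemma sum_power_div_fact_powr_le:
  fixes x \<tau> :: real
  assumes x: "x > 0" and \<tau>: "\<tau> > 0"
  shows "(\<Sum>k\<le>K. (x ^ k / fact k) powr \<tau>) \<le> exp (\<tau> * (x + 1)) * ((x + 1) / min \<tau> 1)"
proof -
  define q where "q = (x / (x + 1)) powr \<tau>"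
  \<comment> \<open>The base lies below 1, so lowering the exponent to \<open>min \<tau> 1\<close>
    only enlarges the power and brings it into the range of Bernoulli's inequality. The geometric
    series in \<open>q\<close> then sums to at most \<open>(x + 1) / min \<tau> 1\<close>.\<close>
  have "q \<le> (1 - 1 / (x + 1)) powr (min \<tau> 1)"
    unfolding q_def using x
    by (subst diff_divide_eq_iff) (auto intro!: powr_mono' simp: field_simps)
  also have "\<dots> \<le> 1 - min \<tau> 1 / (x + 1)"
    using powr_Bernoulli[of "min \<tau> 1" "1 / (x + 1)"] x \<tau> by simp
  finally have q: "1 - q \<ge> min \<tau> 1 / (x + 1)" by simp
  have pos: "min \<tau> 1 / (x + 1) > 0" using x \<tau> by auto
  have q0: "0 \<le> q" "q < 1" using q pos by (auto simp: q_def)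
  have "(\<Sum>k\<le>K. (x ^ k / fact k) powr \<tau>) \<le> (\<Sum>k\<le>K. exp (\<tau> * (x + 1)) * q ^ k)"
  proof (rule sum_mono)
    fix k
    \<comment> \<open>replacing \<open>x\<close> by \<open>x + 1\<close> gains a geometric factor at only polynomial cost in \<open>x\<close>\<close>
    have "x ^ k / fact k = ((x + 1) ^ k / fact k) * (x / (x + 1)) ^ k"
      using x by (simp add: power_divide)
    also have "\<dots> \<le> exp (x + 1) * (x / (x + 1)) ^ k"
      using x by (intro mult_right_mono power_div_fact_le_exp) auto
    finally have "(x ^ k / fact k) powr \<tau> \<le> (exp (x + 1) * (x / (x + 1)) ^ k) powr \<tau>"
      using x \<tau> by (intro powr_mono2) auto
    also have "\<dots> = exp (\<tau> * (x + 1)) * q ^ k"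
      using x by (simp add: powr_mult exp_powr_real mult.commute q_def powr_powr flip: powr_realpow)
    finally show "(x ^ k / fact k) powr \<tau> \<le> exp (\<tau> * (x + 1)) * q ^ k" .
  qed
  also have "\<dots> = exp (\<tau> * (x + 1)) * (\<Sum>k\<le>K. q ^ k)"
    by (simp add: sum_distrib_left)
  also have "(\<Sum>k\<le>K. q ^ k) \<le> 1 / (1 - q)"
    using q0 by (simp add: sum_gp0 divide_right_mono)
  also have "1 / (1 - q) \<le> (x + 1) / min \<tau> 1"
    using frac_le[OF _ _ pos q, of 1 1] by simp
  finally show ?thesis by simp
qed

section \<open>Reduction of \<open>S_gamma\<close> to finite partial sums\<close>

lemma gamma_weight_mult_power:
  "gamma_weight \<rho> \<sigma> C v * m ^ card v
    = fact (card v) powr \<sigma> * (C * m) ^ card v * (\<Prod>j\<in>v. 1 / real j powr \<rho>)"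
  by (simp add: gamma_weight_def prod_dividef power_mult_distrib mult_ac)

lemma gamma_weight_nonneg: "C \<ge> 0 \<Longrightarrow> gamma_weight \<rho> \<sigma> C v \<ge> 0"
  by (simp add: gamma_weight_def prod_nonneg)

lemma S_gamma_eq_SUP:
  assumes "C \<ge> 0" "m \<ge> 0"
  shows "S_gamma \<rho> \<sigma> C m
    = (SUP F\<in>{F. finite F \<and> F \<subseteq> {v. v \<subseteq> {1..} \<and> finite v}}.
        ennreal (\<Sum>v\<in>F. gamma_weight \<rho> \<sigma> C v * m ^ card v))"
  unfolding S_gamma_def using assms
  by (subst nonneg_infsum_complete)
     (auto intro!: SUP_cong sum_ennreal simp: gamma_weight_nonneg)

lemma sum_le_S_gamma:
  assumes "C \<ge> 0" "m \<ge> 0" "finite F" "\<And>v. v \<in> F \<Longrightarrow> v \<subseteq> {1..} \<and> finite v"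
  shows "ennreal (\<Sum>v\<in>F. gamma_weight \<rho> \<sigma> C v * m ^ card v) \<le> S_gamma \<rho> \<sigma> C m"
  using assms by (subst S_gamma_eq_SUP) (auto intro!: SUP_upper)

text \<open>The power sets \<open>Pow {1..L}\<close> are cofinal among the finite families of finite
  sets of positive integers, and the terms are nonnegative.\<close>

lemma S_gamma_le:
  assumes "C \<ge> 0" "m \<ge> 0"
    and "\<And>L. (\<Sum>v\<in>Pow {1..L}. gamma_weight \<rho> \<sigma> C v * m ^ card v) \<le> B"
  shows "S_gamma \<rho> \<sigma> C m \<le> ennreal B"
proof -
  have "(\<Sum>v\<in>F. gamma_weight \<rho> \<sigma> C v * m ^ card v) \<le> B"
    if F: "finite F" "F \<subseteq> {v. v \<subseteq> {1..} \<and> finite v}" for F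
  proof -
    have "finite (\<Union>F)" using F by auto
    then obtain L where "\<Union>F \<subseteq> {..L}"
      using finite_nat_iff_bounded_le by blast
    then have "F \<subseteq> Pow {1..L}"
      using F by fastforce
    then have "(\<Sum>v\<in>F. gamma_weight \<rho> \<sigma> C v * m ^ card v)
        \<le> (\<Sum>v\<in>Pow {1..L}. gamma_weight \<rho> \<sigma> C v * m ^ card v)"
      using assms(1,2) by (intro sum_mono2) (auto simp: gamma_weight_nonneg)
    then show ?thesis
      using assms(3)[of L] by simp
  qed
  then show ?thesis
    using assms(1,2) by (subst S_gamma_eq_SUP) (auto intro!: SUP_least ennreal_leI)
qed

text \<open>The source of the exponent \<open>1 / (\<rho> - \<sigma>)\<close>: taking this root of
  \<open>A\<close> turns the bounds on the terms into powers of exponential series terms.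
  \<open>A\<close> is \<open>C * m\<close> for the lower bound and carries the extra constant for
  the upper one.\<close>

lemma power_div_fact_powr_root:
  fixes A \<rho> \<sigma> :: real
  assumes "A > 0" "\<rho> > \<sigma>"
  shows "((A powr (1 / (\<rho> - \<sigma>))) ^ k / fact k) powr (\<rho> - \<sigma>)
    = fact k powr \<sigma> * A ^ k * fact k powr (- \<rho>)"
proof -
  have "((A powr (1 / (\<rho> - \<sigma>))) ^ k) powr (\<rho> - \<sigma>) = A ^ k"
    using assms by (simp add: powr_powr flip: powr_realpow)
  moreover have "fact k powr (\<rho> - \<sigma>) * (fact k powr \<sigma> * fact k powr (- \<rho>)) = (1::real)"
    by (simp flip: powr_add)
  ultimately show ?thesis
    by (simp add: powr_divide field_simps)
qed

section \<open>Divergence for \<open>\<rho> \<le> \<sigma>\<close> and two-sided bounds for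
  \<open>\<rho> > \<sigma>\<close>\<close>

lemma gamma_weight_initial:
  "gamma_weight \<rho> \<sigma> C {1..k} * m ^ card {1..k}
    = fact k powr \<sigma> * (C * m) ^ k * fact k powr (- \<rho>)"
proof -
  have "(\<Prod>j\<in>{1..k}. 1 / real j powr \<rho>) = fact k powr (- \<rho>)"
    by (simp add: prod_dividef powr_minus_divide fact_prod prod_powr_distrib)
  then show ?thesis
    unfolding gamma_weight_mult_power by simp
qed

text \<open>At \<open>m = 1 / C\<close> the geometric factor is 1, so each of the infinitely many
  sets \<open>{1..k}\<close> contributes \<open>fact k powr (\<sigma> - \<rho>)\<close>, which is at
  least 1.\<close>

lemma S_gamma_eq_top:
  assumes "C > 0" "\<rho> \<le> \<sigma>"
  shows "S_gamma \<rho> \<sigma> C (1 / C) = \<infinity>"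
proof (rule ccontr)
  assume "S_gamma \<rho> \<sigma> C (1 / C) \<noteq> \<infinity>"
  then obtain r where r: "r \<ge> 0" "S_gamma \<rho> \<sigma> C (1 / C) = ennreal r"
    by (metis ennreal_cases infinity_ennreal_def)
  obtain K where K: "r < real K"
    using reals_Archimedean2 by blast
  let ?g = "\<lambda>v. gamma_weight \<rho> \<sigma> C v * (1 / C) ^ card v"
  have inj: "inj_on (\<lambda>k. {1..k}) {..<K}"
    by (rule inj_onI) (metis card_atLeastAtMost diff_Suc_1)
  have "real K = (\<Sum>k<K. 1)"
    by simp
  also have "\<dots> \<le> (\<Sum>k<K. ?g {1..k})"
  proof (rule sum_mono)
    fix k
    show "1 \<le> ?g {1..k}"
      unfolding gamma_weight_initial using assms
      by (simp add: ge_one_powr_ge_zero fact_ge_1 flip: powr_add)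
  qed
  also have "\<dots> = (\<Sum>v\<in>(\<lambda>k. {1..k}) ` {..<K}. ?g v)"
    by (subst sum.reindex[OF inj]) (simp only: o_def)
  finally have "ennreal (real K) \<le> ennreal (\<Sum>v\<in>(\<lambda>k. {1..k}) ` {..<K}. ?g v)"
    by (rule ennreal_leI)
  also have "\<dots> \<le> S_gamma \<rho> \<sigma> C (1 / C)"
    using assms by (intro sum_le_S_gamma) auto
  finally show False
    using r K by simp
qed

lemma S_gamma_upper:
  assumes "\<rho> > 1" "\<rho> > \<sigma>" "C > 0" "m > 0"
  defines "x \<equiv> (exp 1 / min (\<rho> - 1) 1 * C * m) powr (1 / (\<rho> - \<sigma>))"
  shows "S_gamma \<rho> \<sigma> C m
    \<le> ennreal (exp 1 * (exp ((\<rho> - \<sigma>) * (x + 1)) * ((x + 1) / min (\<rho> - \<sigma>) 1)))"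
proof (rule S_gamma_le)
  fix L
  let ?A = "exp 1 / min (\<rho> - 1) 1 * C * m"
  have A: "?A > 0" using assms by simp
  then have x: "x > 0" unfolding x_def by (intro powr_gt_zero[THEN iffD2]) auto
  have "(\<Sum>v\<in>Pow {1..L}. gamma_weight \<rho> \<sigma> C v * m ^ card v)
      = (\<Sum>k\<le>L. (fact k powr \<sigma> * (C * m) ^ k) * esym (\<lambda>j. 1 / real j powr \<rho>) {1..L} k)"
    unfolding gamma_weight_mult_power
    using sum_Pow_by_card[of "{1..L}" "\<lambda>k. fact k powr \<sigma> * (C * m) ^ k"] by simp
  also have "\<dots> \<le> (\<Sum>k\<le>L. exp 1 * (x ^ k / fact k) powr (\<rho> - \<sigma>))"
  proof (rule sum_mono)
    fix k
    have "(fact k powr \<sigma> * (C * m) ^ k) * esym (\<lambda>j. 1 / real j powr \<rho>) {1..L} k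
        \<le> (fact k powr \<sigma> * (C * m) ^ k)
          * (exp 1 * (exp 1 / min (\<rho> - 1) 1) ^ k * fact k powr (- \<rho>))"
      using assms by (intro mult_left_mono esym_le) auto
    \<comment> \<open>The geometric factor from \<open>esym_le\<close> merges with
      \<open>C * m\<close> into \<open>?A\<close>. Only a constant factor stays outside, and it
      disappears in the scaled logarithm.\<close>
    also have "\<dots> = exp 1 * (fact k powr \<sigma> * ?A ^ k * fact k powr (- \<rho>))"
      by (simp only: power_mult_distrib mult_ac)
    also have "\<dots> = exp 1 * (x ^ k / fact k) powr (\<rho> - \<sigma>)"
      unfolding x_def using power_div_fact_powr_root[OF A \<open>\<rho> > \<sigma>\<close>] by simp
    finally show "(fact k powr \<sigma> * (C * m) ^ k) * esym (\<lambda>j. 1 / real j powr \<rho>) {1..L} k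
        \<le> exp 1 * (x ^ k / fact k) powr (\<rho> - \<sigma>)" .
  qed
  also have "\<dots> = exp 1 * (\<Sum>k\<le>L. (x ^ k / fact k) powr (\<rho> - \<sigma>))"
    by (simp add: sum_distrib_left)
  also have "\<dots> \<le> exp 1 * (exp ((\<rho> - \<sigma>) * (x + 1)) * ((x + 1) / min (\<rho> - \<sigma>) 1))"
    using x assms by (intro mult_left_mono sum_power_div_fact_powr_le) auto
  finally show "(\<Sum>v\<in>Pow {1..L}. gamma_weight \<rho> \<sigma> C v * m ^ card v)
    \<le> exp 1 * (exp ((\<rho> - \<sigma>) * (x + 1)) * ((x + 1) / min (\<rho> - \<sigma>) 1))" .
qed (use assms in auto)

lemma S_gamma_lower:
  assumes "\<rho> > \<sigma>" "C > 0" "m > 0"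
  shows "ennreal ((((C * m) powr (1 / (\<rho> - \<sigma>))) ^ k / fact k) powr (\<rho> - \<sigma>)) \<le> S_gamma \<rho> \<sigma> C m"
proof -
  have "ennreal (\<Sum>v\<in>{{1..k}}. gamma_weight \<rho> \<sigma> C v * m ^ card v) \<le> S_gamma \<rho> \<sigma> C m"
    using assms by (intro sum_le_S_gamma) auto
  moreover have "(\<Sum>v\<in>{{1..k}}. gamma_weight \<rho> \<sigma> C v * m ^ card v)
      = (((C * m) powr (1 / (\<rho> - \<sigma>))) ^ k / fact k) powr (\<rho> - \<sigma>)"
    using assms power_div_fact_powr_root[of "C * m" \<sigma> \<rho> k] gamma_weight_initial[of \<rho> \<sigma> C k m]
    by simp
  ultimately show ?thesis by simp
qed

section \<open>Bounds for the logarithm of \<open>S_gamma\<close>\<close>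

lemma ln_S_gamma_upper:
  assumes "\<rho> > 1" "\<rho> > \<sigma>" "C > 0" "m > 0"
  defines "x \<equiv> (exp 1 / min (\<rho> - 1) 1 * C * m) powr (1 / (\<rho> - \<sigma>))"
  shows "ln (enn2real (S_gamma \<rho> \<sigma> C m))
    \<le> 1 + (\<rho> - \<sigma>) * (x + 1) + ln (x + 1) - ln (min (\<rho> - \<sigma>) 1)"
proof -
  let ?U = "exp 1 * (exp ((\<rho> - \<sigma>) * (x + 1)) * ((x + 1) / min (\<rho> - \<sigma>) 1))"
  have "exp 1 / min (\<rho> - 1) 1 * C * m > 0" using assms by simp
  then have x: "x > 0" unfolding x_def by (intro powr_gt_zero[THEN iffD2]) auto
  have upper: "S_gamma \<rho> \<sigma> C m \<le> ennreal ?U"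
    unfolding x_def using assms by (intro S_gamma_upper) auto
  have U: "?U > 0"
    using x \<open>\<rho> > \<sigma>\<close> by (intro mult_pos_pos divide_pos_pos) auto
  \<comment> \<open>The empty set contributes 1. Together with the finite upper bound this makes the
    \<open>enn2real\<close> value positive, as monotonicity of \<open>ln\<close> demands.\<close>
  have "ennreal 1 \<le> S_gamma \<rho> \<sigma> C m"
    using S_gamma_lower[of \<sigma> \<rho> C m 0] assms by simp
  then have "enn2real (S_gamma \<rho> \<sigma> C m) > 0"
    using upper
    by (auto simp: enn2real_positive_iff less_top[symmetric] top_unique
        intro: order.strict_trans2[rotated])
  moreover have "enn2real (S_gamma \<rho> \<sigma> C m) \<le> ?U"
    using upper U by (intro enn2real_leI) auto
  ultimately have "ln (enn2real (S_gamma \<rho> \<sigma> C m)) \<le> ln ?U"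
    by simp
  also have "\<dots> = 1 + (\<rho> - \<sigma>) * (x + 1) + ln (x + 1) - ln (min (\<rho> - \<sigma>) 1)"
    using x \<open>\<rho> > \<sigma>\<close> by (simp add: ln_mult ln_div)
  finally show ?thesis .
qed

lemma ln_S_gamma_lower:
  assumes "\<rho> > \<sigma>" "C > 0" "m > 0" and finite: "S_gamma \<rho> \<sigma> C m < \<infinity>"
  defines "x \<equiv> (C * m) powr (1 / (\<rho> - \<sigma>))"
  assumes x: "x \<ge> 1"
  shows "ln (enn2real (S_gamma \<rho> \<sigma> C m)) \<ge> (\<rho> - \<sigma>) * (x - 2 - ln x)"
proof -
  define k where "k = nat \<lfloor>x\<rfloor>"
  have "(\<rho> - \<sigma>) * (x - 2 - ln x) \<le> (\<rho> - \<sigma>) * ln (x ^ k / fact k)"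
    using power_div_fact_floor_ge[OF x] assms by (simp add: k_def)
  also have "\<dots> = ln ((x ^ k / fact k) powr (\<rho> - \<sigma>))"
    using x by (simp add: ln_powr)
  \<comment> \<open>Finiteness enters here: \<open>enn2real\<close> sends infinity to 0, so it
    preserves order only below infinity.\<close>
  also have "(x ^ k / fact k) powr (\<rho> - \<sigma>) \<le> enn2real (S_gamma \<rho> \<sigma> C m)"
    using S_gamma_lower[of \<sigma> \<rho> C m k] assms enn2real_mono by (fastforce simp: x_def)
  then have "ln ((x ^ k / fact k) powr (\<rho> - \<sigma>)) \<le> ln (enn2real (S_gamma \<rho> \<sigma> C m))"
    using x by (intro ln_mono) auto
  finally show ?thesis .
qed

section \<open>Passage to the limit in \<open>m\<close>\<close>

lemma filterlim_mult_powr_at_top: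
  fixes A p :: real
  assumes "A > 0" "p > 0"
  shows "filterlim (\<lambda>m. (A * m) powr p) at_top at_top"
  using assms by real_asymp

theorem theorem3:
  fixes \<rho> \<sigma> C :: real
  assumes "\<rho> > 1" and "\<sigma> \<ge> 0" and "C > 0"
  shows "((\<forall>m>0. S_gamma \<rho> \<sigma> C m < \<infinity>) \<longleftrightarrow> \<rho> > \<sigma>) \<and>
    (\<rho> > \<sigma> \<longrightarrow>
      Liminf at_top (\<lambda>m::real. ereal (m powr (- (1 / (\<rho> - \<sigma>))) * ln (enn2real (S_gamma \<rho> \<sigma> C m))))
        \<ge> ereal ((\<rho> - \<sigma>) * C powr (1 / (\<rho> - \<sigma>))) \<and>
      Limsup at_top (\<lambda>m::real. ereal (m powr (- (1 / (\<rho> - \<sigma>))) * ln (enn2real (S_gamma \<rho> \<sigma> C m))))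
        \<le> ereal ((\<rho> - \<sigma>) * (exp 1 / min (\<rho> - 1) 1 * C) powr (1 / (\<rho> - \<sigma>))))"
proof (intro conjI impI)
  have finite: "S_gamma \<rho> \<sigma> C m < \<infinity>" if "\<rho> > \<sigma>" "m > 0" for m
    using S_gamma_upper[of \<rho> \<sigma> C m] assms that by (auto intro: order.strict_trans1)
  show "(\<forall>m>0. S_gamma \<rho> \<sigma> C m < \<infinity>) \<longleftrightarrow> \<rho> > \<sigma>"
  proof
    assume "\<forall>m>0. S_gamma \<rho> \<sigma> C m < \<infinity>"
    then have "S_gamma \<rho> \<sigma> C (1 / C) < \<infinity>"
      using assms by simp
    then show "\<rho> > \<sigma>"
      using S_gamma_eq_top[of C \<rho> \<sigma>] assms by (cases "\<rho> > \<sigma>") auto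
  qed (use finite in auto)

  assume \<tau>: "\<rho> > \<sigma>"
  define p where "p = 1 / (\<rho> - \<sigma>)"
  have p: "p > 0" using \<tau> by (simp add: p_def)
  define D where "D = exp 1 / min (\<rho> - 1) 1 * C"
  have D: "D > 0" using assms by (simp add: D_def)
  let ?f = "\<lambda>m. m powr (- p) * ln (enn2real (S_gamma \<rho> \<sigma> C m))"
  \<comment> \<open>With \<open>x = (A * m) powr p\<close> the scaling factor becomes
    \<open>A powr p / x\<close>. Both scaled bounds are then functions of \<open>x\<close> alone,
    called \<open>lo\<close> (with \<open>A = C\<close>) and \<open>up\<close> (with
    \<open>A = D\<close>), and their limits are taken as \<open>x\<close> tends to infinity.\<close>
  have scale: "m powr (- p) = A powr p / (A * m) powr p" if "m > 0" "A > 0" for A m :: real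
    using that by (simp add: powr_mult powr_minus_divide)

  define lo where "lo x = C powr p * ((\<rho> - \<sigma>) * (x - 2 - ln x) / x)" for x
  have "((\<lambda>x. (x - 2 - ln x) / x :: real) \<longlongrightarrow> 1) at_top"
    by real_asymp
  from tendsto_mult_left[OF this, of "C powr p * (\<rho> - \<sigma>)"]
  have "(lo \<longlongrightarrow> (\<rho> - \<sigma>) * C powr p) at_top"
    by (simp add: lo_def [abs_def] mult_ac)
  from filterlim_compose[OF this filterlim_mult_powr_at_top[OF \<open>C > 0\<close> p]]
  have "((\<lambda>m. ereal (lo ((C * m) powr p))) \<longlongrightarrow> ereal ((\<rho> - \<sigma>) * C powr p)) at_top"
    by simp
  then have "ereal ((\<rho> - \<sigma>) * C powr p) = Liminf at_top (\<lambda>m. ereal (lo ((C * m) powr p)))"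
    by (intro lim_imp_Liminf[symmetric]) auto
  also have "\<dots> \<le> Liminf at_top (\<lambda>m. ereal (?f m))"
  proof (rule Liminf_mono)
    have "\<forall>\<^sub>F m in at_top. (C * m) powr p \<ge> 1"
      using filterlim_mult_powr_at_top[OF \<open>C > 0\<close> p] by (simp add: filterlim_at_top)
    then show "\<forall>\<^sub>F m in at_top. ereal (lo ((C * m) powr p)) \<le> ereal (?f m)"
      using eventually_gt_at_top[of 0]
    proof eventually_elim
      case (elim m)
      have "lo ((C * m) powr p) = m powr (- p) * ((\<rho> - \<sigma>) * ((C * m) powr p - 2 - ln ((C * m) powr p)))"
        using scale[of m C] elim assms by (simp add: lo_def)
      also have "\<dots> \<le> ?f m"
        using ln_S_gamma_lower[of \<sigma> \<rho> C m] finite[of m] elim assms \<tau>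
        by (intro mult_left_mono) (auto simp: p_def)
      finally show ?case by simp
    qed
  qed
  finally show "ereal ((\<rho> - \<sigma>) * C powr (1 / (\<rho> - \<sigma>)))
      \<le> Liminf at_top (\<lambda>m. ereal (m powr (- (1 / (\<rho> - \<sigma>))) * ln (enn2real (S_gamma \<rho> \<sigma> C m))))"
    by (simp add: p_def)

  define up where "up x = D powr p *
    ((1 + (\<rho> - \<sigma>) * (x + 1) + ln (x + 1) - ln (min (\<rho> - \<sigma>) 1)) / x)" for x
  have "((\<lambda>x. (1 + t * (x + 1) + ln (x + 1) - c) / x) \<longlongrightarrow> t) at_top" if "t > 0" for t c :: real
    using that by real_asymp
  from tendsto_mult_left[OF this, of "\<rho> - \<sigma>" "D powr p" "ln (min (\<rho> - \<sigma>) 1)"]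
  have "(up \<longlongrightarrow> (\<rho> - \<sigma>) * D powr p) at_top"
    using \<tau> by (simp add: up_def [abs_def] mult_ac)
  from filterlim_compose[OF this filterlim_mult_powr_at_top[OF D p]]
  have "((\<lambda>m. ereal (up ((D * m) powr p))) \<longlongrightarrow> ereal ((\<rho> - \<sigma>) * D powr p)) at_top"
    by simp
  then have upper: "Limsup at_top (\<lambda>m. ereal (up ((D * m) powr p))) = ereal ((\<rho> - \<sigma>) * D powr p)"
    by (intro lim_imp_Limsup) auto
  have "Limsup at_top (\<lambda>m. ereal (?f m)) \<le> Limsup at_top (\<lambda>m. ereal (up ((D * m) powr p)))"
  proof (rule Limsup_mono)
    show "\<forall>\<^sub>F m in at_top. ereal (?f m) \<le> ereal (up ((D * m) powr p))"
      using eventually_gt_at_top[of 0]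
    proof eventually_elim
      case (elim m)
      have "?f m \<le> m powr (- p) * (1 + (\<rho> - \<sigma>) * ((D * m) powr p + 1)
          + ln ((D * m) powr p + 1) - ln (min (\<rho> - \<sigma>) 1))"
        using ln_S_gamma_upper[of \<rho> \<sigma> C m] elim assms \<tau>
        by (intro mult_left_mono) (auto simp: p_def D_def)
      also have "\<dots> = up ((D * m) powr p)"
        using scale[of m D] elim D by (simp add: up_def)
      finally show ?case by simp
    qed
  qed
  then show "Limsup at_top (\<lambda>m. ereal (m powr (- (1 / (\<rho> - \<sigma>))) * ln (enn2real (S_gamma \<rho> \<sigma> C m))))
      \<le> ereal ((\<rho> - \<sigma>) * (exp 1 / min (\<rho> - 1) 1 * C) powr (1 / (\<rho> - \<sigma>)))"
    unfolding upper by (simp add: p_def D_def)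
qed

end
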